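(* $c(K_3,C_5)=c_{10/17}(K_3,C_5)=3/34$.
   Context: $K_3$ is the triangle and $C_5$ the cycle of length 5. For graphs $H,G$, $t(H,G)=\hom(H,G)/v(G)^{v(H)}$ is the probability that a uniformly random map $V(H)\to V(G)$ is a homomorphism. Let $G_1,G_2,\dots$ be a sequence containing every finite graph exactly once; $\overline{G}$ is the complement of $G$. For $\lambda\in[0,2]$, $c_\lambda(H_1,H_2):=\liminf_{n\to\infty}\left[\lambda\, t(H_1,G_n)+(2-\lambda)\, t(H_2,\overline{G_n})\right]$, and $c(H_1,H_2):=\sup_{\lambda\in[0,2]}c_\lambda(H_1,H_2)$. *)

theory Defs
  imports
    "HOL-Analysis.Analysis"
    "Graph_Theory.Graph_Theory"
begin

text \<open>
  A finite simple graph is a \<^const>\<open>pair_graph\<close>: a finite loopfree symmetric digraph whose arcs are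
  pairs of vertices, so each undirected edge is present as two opposite arcs.
\<close>

definition graph_homs :: "'a pair_pre_digraph \<Rightarrow> 'b pair_pre_digraph \<Rightarrow> ('a \<Rightarrow> 'b) set" where
  "graph_homs H G =
     {f \<in> pverts H \<rightarrow>\<^sub>E pverts G. \<forall>(u, v) \<in> parcs H. (f u, f v) \<in> parcs G}"

definition hom_density :: "'a pair_pre_digraph \<Rightarrow> 'b pair_pre_digraph \<Rightarrow> real" where
  "hom_density H G = real (card (graph_homs H G)) / real (card (pverts G)) ^ card (pverts H)"

definition graph_complement :: "'a pair_pre_digraph \<Rightarrow> 'a pair_pre_digraph" where
  "graph_complement G =
     \<lparr> pverts = pverts G,
       parcs = {(u, v) \<in> pverts G \<times> pverts G. u \<noteq> v \<and> (u, v) \<notin> parcs G} \<rparr>"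

definition complete_graph :: "nat \<Rightarrow> nat pair_pre_digraph" where
  "complete_graph n =
     \<lparr> pverts = {..<n}, parcs = {(u, v) \<in> {..<n} \<times> {..<n}. u \<noteq> v} \<rparr>"

text \<open>Meaningful for \<open>n \<ge> 3\<close> only.\<close>
definition cycle_graph :: "nat \<Rightarrow> nat pair_pre_digraph" where
  "cycle_graph n =
     \<lparr> pverts = {..<n},
       parcs = {(u, v) \<in> {..<n} \<times> {..<n}. v = Suc u mod n \<or> u = Suc v mod n} \<rparr>"

text \<open>
  Graphs are listed up to isomorphism.  Taking the vertices to be natural numbers loses nothing,
  since every finite graph is isomorphic to one of this kind.  The graph without vertices is listed
  too; being a single term, it does not affect the limes inferior below.
\<close>
definition enumerates_finite_graphs :: "(nat \<Rightarrow> nat pair_pre_digraph) \<Rightarrow> bool" where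
  "enumerates_finite_graphs G \<longleftrightarrow>
     (\<forall>n. pair_graph (G n)) \<and>
     (\<forall>H :: nat pair_pre_digraph.
        pair_graph H \<longrightarrow> (\<exists>!n. digraph_iso (with_proj H) (with_proj (G n))))"

text \<open>The values are extended reals because \<^const>\<open>liminf\<close> and \<^const>\<open>Sup\<close> need a complete lattice.\<close>
definition c_weighted ::
    "(nat \<Rightarrow> nat pair_pre_digraph) \<Rightarrow> real \<Rightarrow> 'a pair_pre_digraph \<Rightarrow> 'b pair_pre_digraph \<Rightarrow> ereal" where
  "c_weighted G l H1 H2 =
     liminf (\<lambda>n. ereal (l * hom_density H1 (G n)
                        + (2 - l) * hom_density H2 (graph_complement (G n))))"

definition c_sup ::
    "(nat \<Rightarrow> nat pair_pre_digraph) \<Rightarrow> 'a pair_pre_digraph \<Rightarrow> 'b pair_pre_digraph \<Rightarrow> ereal" where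
  "c_sup G H1 H2 = (SUP l \<in> {0..2}. c_weighted G l H1 H2)"

lemma pair_graphI:
  assumes "finite (pverts G)" "parcs G \<subseteq> pverts G \<times> pverts G"
    and "\<And>u v. (u, v) \<in> parcs G \<Longrightarrow> (v, u) \<in> parcs G"
    and "\<And>u. (u, u) \<notin> parcs G"
  shows "pair_graph G"
proof -
  have "finite (parcs G)"
    using assms(1,2) by (meson finite_SigmaI finite_subset)
  moreover have "symmetric (with_proj G)"
    using assms(3) by (auto simp: symmetric_def intro: symI)
  ultimately show ?thesis
    using assms by unfold_locales auto
qed

lemma pair_graph_complement:
  assumes "pair_graph G"
  shows "pair_graph (graph_complement G)"
proof -
  interpret pair_graph G by fact
  have "(v, u) \<in> parcs G" if "(u, v) \<in> parcs G" for u v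
    using that pair_sym_arcs by (auto simp: symmetric_def dest: symD)
  then show ?thesis
    using pair_finite_verts by (intro pair_graphI) (auto simp: graph_complement_def)
qed

lemma complete_digraph_complete_graph: "complete_digraph n (with_proj (complete_graph n))"
  unfolding complete_digraph_pair_def by (auto simp: complete_graph_def)

lemma pair_graph_cycle_graph:
  assumes "n \<ge> 3"
  shows "pair_graph (cycle_graph n)"
  using assms by (intro pair_graphI) (auto simp: cycle_graph_def mod_Suc split: if_splits)

lemma digraph_iso_pair_iff:
  assumes "pair_graph G" "pair_graph H"
  shows "digraph_iso (with_proj G) (with_proj H) \<longleftrightarrow>
    (\<exists>f. bij_betw f (pverts G) (pverts H) \<and> parcs H = map_prod f f ` parcs G)"
proof
  interpret G: pair_graph G by fact
  assume "digraph_iso (with_proj G) (with_proj H)"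
  then obtain h where h: "G.digraph_isomorphism h" "with_proj H = app_iso h (with_proj G)"
    by (auto simp: digraph_iso_def)
  then have eqs: "pverts H = iso_verts h ` pverts G" "parcs H = iso_arcs h ` parcs G"
      "iso_tail h = fst" "iso_head h = snd"
    by (auto simp: app_iso_def with_proj_def)
  have "iso_arcs h e = map_prod (iso_verts h) (iso_verts h) e" if "e \<in> parcs G" for e
    using h(1) that eqs(3,4)
    by (auto simp: G.digraph_isomorphism_def prod_eq_iff)
  then show "\<exists>f. bij_betw f (pverts G) (pverts H) \<and> parcs H = map_prod f f ` parcs G"
    using h(1) eqs
    by (intro exI[of _ "iso_verts h"]) (auto simp: G.digraph_isomorphism_def bij_betw_def)
next
  interpret G: pair_graph G by fact
  assume "\<exists>f. bij_betw f (pverts G) (pverts H) \<and> parcs H = map_prod f f ` parcs G"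
  then obtain f where f: "bij_betw f (pverts G) (pverts H)" "parcs H = map_prod f f ` parcs G"
    by blast
  define h where "h = \<lparr> iso_verts = f, iso_arcs = map_prod f f, iso_head = snd, iso_tail = fst \<rparr>"
  have "inj_on (map_prod f f) (pverts G \<times> pverts G)"
    using f(1) by (intro map_prod_inj_on) (auto simp: bij_betw_def)
  then have "inj_on (map_prod f f) (parcs G)"
    by (rule inj_on_subset) (auto dest: G.in_arcsD1 G.in_arcsD2)
  then have "G.digraph_isomorphism h"
    using f(1) G.wf_digraph by (auto simp: G.digraph_isomorphism_def h_def bij_betw_def)
  moreover have "with_proj H = app_iso h (with_proj G)"
    using f by (auto simp: app_iso_def with_proj_def h_def bij_betw_def)
  ultimately show "digraph_iso (with_proj G) (with_proj H)"
    by (auto simp: digraph_iso_def)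
qed

lemma ex_enumerates_finite_graphs: "\<exists>G. enumerates_finite_graphs G"
proof -
  define S where "S = {H :: nat pair_pre_digraph. pair_graph H}"
  define R where
    "R H H' \<longleftrightarrow> (\<exists>f. bij_betw f (pverts H) (pverts H') \<and> parcs H' = map_prod f f ` parcs H)"
    for H H' :: "nat pair_pre_digraph"
  have iso: "digraph_iso (with_proj H) (with_proj H') \<longleftrightarrow> R H H'" if "H \<in> S" "H' \<in> S" for H H'
    using digraph_iso_pair_iff that by (auto simp: S_def R_def)
  have refl: "R H H" for H
    unfolding R_def by (rule exI[of _ id]) (simp add: map_prod.id)
  have sub: "parcs H \<subseteq> pverts H \<times> pverts H" if "H \<in> S" for H
    using that by (auto simp: S_def pair_graph_def pair_digraph_def pair_fin_digraph_def
        dest: pair_wf_digraph.in_arcsD1 pair_wf_digraph.in_arcsD2)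
  have sym: "R H' H" if "R H H'" "H \<in> S" for H H'
  proof -
    obtain f where f: "bij_betw f (pverts H) (pverts H')" "parcs H' = map_prod f f ` parcs H"
      using \<open>R H H'\<close> by (auto simp: R_def)
    let ?g = "inv_into (pverts H) f"
    have "map_prod ?g ?g (map_prod f f e) = e" if "e \<in> parcs H" for e
      using f(1) sub[OF \<open>H \<in> S\<close>] that by (auto simp: bij_betw_def)
    then have "map_prod ?g ?g ` parcs H' = parcs H"
      unfolding f(2) image_image by simp
    then show ?thesis
      using bij_betw_inv_into[OF f(1)] unfolding R_def by metis
  qed
  have trans: "R H K" if "R H H'" "R H' K" for H H' K
  proof -
    obtain f g where fg:
      "bij_betw f (pverts H) (pverts H')" "parcs H' = map_prod f f ` parcs H"
      "bij_betw g (pverts H') (pverts K)" "parcs K = map_prod g g ` parcs H'"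
      using \<open>R H H'\<close> \<open>R H' K\<close> by (auto simp: R_def)
    have "parcs K = map_prod (g \<circ> f) (g \<circ> f) ` parcs H"
      unfolding fg(4) fg(2) image_comp map_prod.comp by simp
    then show ?thesis
      using bij_betw_trans[OF fg(1,3)] unfolding R_def by blast
  qed
  define rep where "rep H = (SOME H'. H' \<in> S \<and> R H H')" for H
  have rep: "rep H \<in> S" "R H (rep H)" if "H \<in> S" for H
    using someI[of "\<lambda>H'. H' \<in> S \<and> R H H'" H] refl[of H] that unfolding rep_def by simp_all
  have rep_eq: "rep H = rep H'" if "R H H'" "H \<in> S" for H H'
  proof -
    have "R H K \<longleftrightarrow> R H' K" for K
      using trans[OF that(1), of K] trans[OF sym[OF that], of K] by blast
    then show ?thesis by (simp add: rep_def)
  qed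
  have "countable S"
  proof (rule countable_image_inj_on)
    have "finite (pverts H) \<and> finite (parcs H)" if "H \<in> S" for H
      using that sub by (auto simp: S_def pair_graph_def pair_digraph_def pair_fin_digraph_def
          pair_fin_digraph_axioms_def)
    then have "(\<lambda>H. (pverts H, parcs H)) ` S \<subseteq> Collect finite \<times> Collect finite"
      by auto
    then show "countable ((\<lambda>H. (pverts H, parcs H)) ` S)"
      by (rule countable_subset) (intro countable_SIGMA countable_Collect_finite)
    show "inj_on (\<lambda>H. (pverts H, parcs H)) S"
      by (auto intro!: inj_onI)
  qed
  then have "countable (rep ` S)" by simp
  moreover have "infinite (rep ` S)"
  proof
    assume "finite (rep ` S)"
    then have fin: "finite ((\<lambda>H. card (pverts H)) ` rep ` S)" by simp
    have "n \<in> (\<lambda>H. card (pverts H)) ` rep ` S" for n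
    proof -
      have S: "complete_graph n \<in> S"
        by (auto simp: S_def complete_graph_def intro!: pair_graphI)
      have "card (pverts (rep (complete_graph n))) = card (pverts (complete_graph n))"
        using rep(2)[OF S] by (auto simp: R_def dest!: bij_betw_same_card)
      then have "card (pverts (rep (complete_graph n))) = n"
        by (simp add: complete_graph_def)
      then show ?thesis using S by (metis imageI)
    qed
    then have "(\<lambda>H. card (pverts H)) ` rep ` S = UNIV" by blast
    then show False using fin by simp
  qed
  ultimately have bij: "bij_betw (from_nat_into (rep ` S)) UNIV (rep ` S)"
    by (rule bij_betw_from_nat_into)
  define G where "G = from_nat_into (rep ` S)"
  have G: "G n \<in> rep ` S" for n
    using bij by (auto simp: G_def bij_betw_def)
  have GS: "G n \<in> S" for n
    using G[of n] rep(1) by auto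
  have "\<exists>!n. R H (G n)" if "H \<in> S" for H
  proof -
    have "rep H \<in> range G"
      using bij that by (simp add: G_def bij_betw_def)
    then obtain n where n: "G n = rep H" by (elim rangeE) (rule that, simp)
    have "m = n" if "R H (G m)" for m
    proof -
      obtain K where K: "K \<in> S" "G m = rep K" using G[of m] by auto
      have "R K H"
        using trans[OF rep(2)[OF K(1)]] sym[OF that \<open>H \<in> S\<close>] K(2) by simp
      then have "G m = G n" using K n rep_eq[of K H] by simp
      moreover have "inj G"
        using bij by (simp add: G_def bij_betw_def)
      ultimately show ?thesis by (simp add: inj_eq)
    qed
    moreover have "R H (G n)" using n rep(2)[OF that] by simp
    ultimately show ?thesis by blast
  qed
  then have "\<exists>!n. digraph_iso (with_proj H) (with_proj (G n))" if "H \<in> S" for H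
    using iso[OF that GS] that by simp
  then have "enumerates_finite_graphs G"
    using GS unfolding enumerates_finite_graphs_def S_def by simp
  then show ?thesis by blast
qed

end

theory Submission imports Defs begin

text \<open>
  Put \<open>s = 1\<close> on non-edges and the diagonal, \<open>s = -1\<close> on edges. Expanding
  \<open>10 t(K\<^sub>3) + 24 t(C\<^sub>5)\<close> in terms of \<open>s\<close>, the linear term cancels, and the terms counting paths in \<open>s\<close>
  form a non-negative quantity by completing squares in the row sums of \<open>s\<close>. What is left is
  \<open>(6 + (2 - 5 \<tau>\<^sub>3 + 3 \<tau>\<^sub>5)) / 4\<close>, where \<open>\<tau>\<^sub>3\<close> and \<open>\<tau>\<^sub>5\<close> are the mean signs of triangles and
  pentagons. The inequality \<open>2 - 5 \<tau>\<^sub>3 + 3 \<tau>\<^sub>5 \<ge> 0\<close> already holds for every signed \<open>K\<^sub>5\<close>, hence on average.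
  This gives \<open>3/34\<close> as a lower bound at \<open>\<lambda> = 10/17\<close>.

  For the upper bound, balanced complete bipartite graphs have densities \<open>(0, 1/16)\<close>, which suffices
  for \<open>\<lambda> \<ge> 10/17\<close>, and the graphs whose complement is a blow-up of the hexagon with loops have
  densities \<open>(1/18, 17/432)\<close>, which suffices for \<open>\<lambda> \<le> 10/17\<close>.
\<close>

section \<open>Sums over tuples\<close>

lemma sum_PiE_insert:
  assumes "i \<notin> I"
  shows "(\<Sum>f\<in>insert i I \<rightarrow>\<^sub>E V. g f) = (\<Sum>y\<in>V. \<Sum>f\<in>I \<rightarrow>\<^sub>E V. g (f(i := y)))"
proof -
  have "inj_on (\<lambda>(y, f). f(i := y)) (V \<times> (I \<rightarrow>\<^sub>E V))"
    using inj_combinator[OF assms, of "\<lambda>_. V"] by simp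
  then show ?thesis
    by (simp add: PiE_insert_eq sum.reindex sum.cartesian_product case_prod_unfold)
qed

lemma sum_PiE_permute:
  assumes "\<pi> permutes I"
  shows "(\<Sum>f\<in>I \<rightarrow>\<^sub>E V. g (f \<circ> \<pi>)) = (\<Sum>f\<in>I \<rightarrow>\<^sub>E V. g f)"
proof (rule sum.reindex_bij_witness[where i = "\<lambda>f. f \<circ> inv \<pi>" and j = "\<lambda>f. f \<circ> \<pi>"])
  have *: "f \<circ> \<rho> \<in> I \<rightarrow>\<^sub>E V" if "\<rho> permutes I" "f \<in> I \<rightarrow>\<^sub>E V" for f \<rho>
    using that permutes_in_image[OF that(1)]
    by (auto simp: PiE_iff extensional_def permutes_not_in)
  show "f \<circ> \<pi> \<in> I \<rightarrow>\<^sub>E V" "f \<circ> inv \<pi> \<in> I \<rightarrow>\<^sub>E V" if "f \<in> I \<rightarrow>\<^sub>E V" for f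
    using that * assms permutes_inv by blast+
qed (use permutes_inv_o[OF assms] in \<open>simp_all add: comp_assoc\<close>)

text \<open>The order 2, 1, 0 is the one in which \<open>lessThan_Suc\<close> peels off coordinates:
  the largest index becomes the outermost sum.\<close>

lemma sum_PiE_3:
  fixes c :: "'a \<Rightarrow> 'a \<Rightarrow> 'a \<Rightarrow> 'b :: comm_monoid_add"
  shows "(\<Sum>f\<in>{..<3::nat} \<rightarrow>\<^sub>E V. c (f 2) (f 1) (f 0)) = (\<Sum>x\<in>V. \<Sum>y\<in>V. \<Sum>z\<in>V. c x y z)"
  by (simp add: numeral_eq_Suc lessThan_Suc sum_PiE_insert)

text \<open>Edge patterns that differ only in the names of their vertices have equal sums over all
  5-tuples. The symmetry arguments for triangles, paths and pentagons below rest on this.\<close>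

lemma sum_PiE_5_permute:
  assumes "distinct [i, j, k, l, m]" "{i, j, k, l, m} \<subseteq> {..<5::nat}"
  shows "(\<Sum>f\<in>{..<5} \<rightarrow>\<^sub>E V. c (f i) (f j) (f k) (f l) (f m))
       = (\<Sum>f\<in>{..<5::nat} \<rightarrow>\<^sub>E V. c (f 0) (f 1) (f 2) (f 3) (f 4))"
proof -
  define \<pi> where "\<pi> t = (if t < 5 then [i, j, k, l, m] ! t else t)" for t
  have five: "{..<5::nat} = {0, 1, 2, 3, 4}" by auto
  have "inj_on \<pi> {..<5}"
    using assms(1) by (auto simp: \<pi>_def inj_on_def nth_eq_iff_index_eq)
  moreover have "\<pi> ` {..<5} \<subseteq> {..<5}"
    using assms(2) unfolding five by (simp add: \<pi>_def)
  ultimately have "bij_betw \<pi> {..<5} {..<5}"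
    by (simp add: bij_betw_def endo_inj_surj)
  then have "\<pi> permutes {..<5}"
    by (rule bij_imp_permutes) (simp add: \<pi>_def)
  from sum_PiE_permute[OF this, where V = V and g = "\<lambda>f. c (f 0) (f 1) (f 2) (f 3) (f 4)"]
  show ?thesis by (simp add: \<pi>_def)
qed

lemma sum_PiE_5:
  fixes c :: "'a \<Rightarrow> 'a \<Rightarrow> 'a \<Rightarrow> 'a \<Rightarrow> 'a \<Rightarrow> 'b :: comm_monoid_add"
  shows "(\<Sum>f\<in>{..<5::nat} \<rightarrow>\<^sub>E V. c (f 0) (f 1) (f 2) (f 3) (f 4))
     = (\<Sum>v\<in>V. \<Sum>w\<in>V. \<Sum>x\<in>V. \<Sum>y\<in>V. \<Sum>z\<in>V. c v w x y z)"
proof -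
  have "(\<Sum>f\<in>{..<5::nat} \<rightarrow>\<^sub>E V. c (f 0) (f 1) (f 2) (f 3) (f 4))
      = (\<Sum>f\<in>{..<5::nat} \<rightarrow>\<^sub>E V. c (f 4) (f 3) (f 2) (f 1) (f 0))"
    by (rule sum_PiE_5_permute[symmetric]) auto
  also have "\<dots> = (\<Sum>v\<in>V. \<Sum>w\<in>V. \<Sum>x\<in>V. \<Sum>y\<in>V. \<Sum>z\<in>V. c v w x y z)"
    by (simp add: numeral_eq_Suc lessThan_Suc sum_PiE_insert)
  finally show ?thesis .
qed

text \<open>Unused summation variables are kept so that the left-hand sides match \<open>sum_PiE_5\<close>.\<close>
lemma sums_via_row_sums:
  fixes s :: "'a \<Rightarrow> 'a \<Rightarrow> real" and V :: "'a set"
  defines "R \<equiv> \<lambda>x. \<Sum>y\<in>V. s x y"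
  defines "Q \<equiv> \<lambda>x. \<Sum>y\<in>V. s x y * R y"
  shows
   "(\<Sum>a\<in>V. \<Sum>b\<in>V. \<Sum>c\<in>V. \<Sum>d\<in>V. \<Sum>e\<in>V. s a b) = real (card V)^3 * (\<Sum>a\<in>V. R a)" (is ?A)
   "(\<Sum>a\<in>V. \<Sum>b\<in>V. \<Sum>c\<in>V. \<Sum>d\<in>V. \<Sum>e\<in>V. s a b * s a c) = real (card V)^2 * (\<Sum>a\<in>V. (R a)\<^sup>2)" (is ?B)
   "(\<Sum>a\<in>V. \<Sum>b\<in>V. \<Sum>c\<in>V. \<Sum>d\<in>V. \<Sum>e\<in>V. s a b * s c d) = real (card V) * (\<Sum>a\<in>V. R a)\<^sup>2" (is ?C)
   "(\<Sum>a\<in>V. \<Sum>b\<in>V. \<Sum>c\<in>V. \<Sum>d\<in>V. \<Sum>e\<in>V. s a b * (s a c * s c d)) = real (card V) * (\<Sum>a\<in>V. R a * Q a)" (is ?D)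
   "(\<Sum>a\<in>V. \<Sum>b\<in>V. \<Sum>c\<in>V. \<Sum>d\<in>V. \<Sum>e\<in>V. s a b * (s c d * s c e)) = (\<Sum>a\<in>V. R a) * (\<Sum>a\<in>V. (R a)\<^sup>2)" (is ?E)
   "(\<Sum>a\<in>V. \<Sum>b\<in>V. \<Sum>c\<in>V. \<Sum>d\<in>V. \<Sum>e\<in>V. (s a b * s b c) * (s a d * s d e)) = (\<Sum>a\<in>V. (Q a)\<^sup>2)" (is ?F)
proof -
  have R: "(\<Sum>y\<in>V. s x y) = R x" for x by (simp add: R_def)
  have Q: "(\<Sum>y\<in>V. s x y * R y) = Q x" for x by (simp add: Q_def)
  note pull = sum_distrib_left[symmetric] sum_distrib_right[symmetric] R Q
    power2_eq_square power3_eq_cube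
  show ?A by (simp add: pull)
  show ?B by (simp add: pull)
  show ?C by (simp add: pull)
  show ?D by (simp add: pull)
  show ?E by (simp add: pull)
  show ?F by (simp add: pull del: mult.assoc)
qed

section \<open>Signed complete graphs\<close>

text \<open>
  The variables are the signs of the six triangles through a fixed vertex of \<open>K\<^sub>5\<close>. The first four
  cubic terms are then the signs of the other triangles and the last twelve those of the pentagons.
\<close>
lemma signed_K5:
  fixes a b c d e f :: real
  assumes "\<bar>a\<bar> = 1" "\<bar>b\<bar> = 1" "\<bar>c\<bar> = 1" "\<bar>d\<bar> = 1" "\<bar>e\<bar> = 1" "\<bar>f\<bar> = 1"
  shows "0 \<le> 8 - 2 * (a + b + c + d + e + f + a * b * d + a * c * e + b * c * f + d * e * f)
    + (a * d * f + a * e * f + b * d * e + b * f * e + c * e * d + c * f * d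
     + a * b * f + b * a * e + a * c * f + c * a * d + c * b * d + b * c * e)"
proof -
  have "x = 1 \<or> x = -1" if "\<bar>x\<bar> = 1" for x :: real
    using that by linarith
  note this[OF assms(1)] this[OF assms(2)] this[OF assms(3)]
    this[OF assms(4)] this[OF assms(5)] this[OF assms(6)]
  then show ?thesis by (elim disjE) simp_all
qed

text \<open>Unit modulus includes the diagonal, so that pointwise sign inequalities cover tuples
  with repeated vertices and may be summed over all maps.\<close>

locale sign_kernel =
  fixes V :: "'a set" and s :: "'a \<Rightarrow> 'a \<Rightarrow> real"
  assumes finite_V: "finite V"
    and abs_s: "\<bar>s x y\<bar> = 1"
    and s_sym: "s x y = s y x"
begin

definition tri :: "'a \<Rightarrow> 'a \<Rightarrow> 'a \<Rightarrow> real" where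
  "tri x y z = s x y * s y z * s z x"

definition pent :: "'a \<Rightarrow> 'a \<Rightarrow> 'a \<Rightarrow> 'a \<Rightarrow> 'a \<Rightarrow> real" where
  "pent v w x y z = s v w * s w x * s x y * s y z * s z v"

lemma s_square: "s x y * s x y = 1"
  using abs_s[of x y] by (metis abs_mult_self_eq mult_1)

lemma abs_tri: "\<bar>tri x y z\<bar> = 1"
  by (simp add: tri_def abs_mult abs_s)

text \<open>Each edge at \<open>w\<close> lies in two of the three triangles on the right, so its
  sign cancels. Hence, among five vertices, the six triangles through one vertex determine the other
  four.\<close>

lemma tri_cocycle: "tri x y z = tri w x y * tri w x z * tri w y z"
proof -
  have "tri w x y * tri w x z * tri w y z
      = (s w x * s w x) * (s w y * s w y) * (s w z * s w z) * (s x y * s y z * s z x)"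
    by (simp only: tri_def s_sym[of x w] s_sym[of y w] s_sym[of z w] s_sym[of z x] mult_ac)
  also have "\<dots> = tri x y z"
    by (simp only: s_square mult_1 tri_def)
  finally show ?thesis ..
qed

text \<open>The pentagon is cut into triangles from \<open>v\<close>; the diagonals
  \<open>s v x\<close> and \<open>s v y\<close> are used twice and cancel.\<close>

lemma pent_triangulation: "pent v w x y z = tri v w x * tri v x y * tri v y z"
proof -
  have "tri v w x * tri v x y * tri v y z
      = (s v x * s v x) * (s v y * s v y) * (s v w * s w x * s x y * s y z * s z v)"
    by (simp only: tri_def s_sym[of x v] s_sym[of y v] mult_ac)
  also have "\<dots> = pent v w x y z"
    by (simp only: s_square mult_1 pent_def)
  finally show ?thesis ..
qed

lemma tri_flip: "tri x z y = tri x y z"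
  by (simp only: tri_def s_sym[of z y] s_sym[of x y] s_sym[of x z] mult_ac)

text \<open>The lists run over the ten triangles and the twelve Hamiltonian cycles on five vertices.
  The relations above express them in the six triangles through \<open>v\<close>, as
  \<open>signed_K5\<close> requires.\<close>

lemma tri_pent_pointwise:
  "0 \<le> 8 - 2 * (tri v w x + tri v w y + tri v w z + tri v x y + tri v x z + tri v y z
      + tri w x y + tri w x z + tri w y z + tri x y z)
    + (pent v w x y z + pent v w x z y + pent v w y x z + pent v w y z x
      + pent v w z x y + pent v w z y x + pent v x w y z + pent v y w x z
      + pent v x w z y + pent v z w x y + pent v z w y x + pent v y w z x)"
proof -
  note flips = tri_flip[of v x w] tri_flip[of v y w] tri_flip[of v z w]
    tri_flip[of v y x] tri_flip[of v z x] tri_flip[of v z y]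
  note cocycles = tri_cocycle[of w x y v] tri_cocycle[of w x z v]
    tri_cocycle[of w y z v] tri_cocycle[of x y z v]
  show ?thesis
    using signed_K5[OF abs_tri abs_tri abs_tri abs_tri abs_tri abs_tri,
        of v w x v w y v w z v x y v x z v y z]
    by (simp only: pent_triangulation cocycles flips)
qed

abbreviation maps :: "(nat \<Rightarrow> 'a) set" where
  "maps \<equiv> {..<5} \<rightarrow>\<^sub>E V"

abbreviation N :: real where "N \<equiv> real (card V)"

lemma card_maps: "real (card maps) = N ^ 5"
  using finite_V by (simp add: card_PiE)

text \<open>Summing the pointwise inequality over all maps makes the ten triangle terms equal, and
  likewise the twelve pentagon terms; then 4 is divided out.\<close>

lemma tri_pent_sum:
  "0 \<le> 2 * N ^ 5 - 5 * (\<Sum>f\<in>maps. tri (f 0) (f 1) (f 2))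
          + 3 * (\<Sum>f\<in>maps. pent (f 0) (f 1) (f 2) (f 3) (f 4))"
proof -
  define T where "T i j k = (\<Sum>f\<in>maps. tri (f i) (f j) (f k))" for i j k
  define P where "P i j k l m = (\<Sum>f\<in>maps. pent (f i) (f j) (f k) (f l) (f m))" for i j k l m
  \<comment> \<open>The indices \<open>l\<close> and \<open>m\<close> complete the triple to a
    permutation.\<close>
  have T: "T i j k = T 0 1 2" if "distinct [i, j, k, l, m]" "{i, j, k, l, m} \<subseteq> {..<5}" for i j k l m
    using sum_PiE_5_permute[OF that, where c = "\<lambda>a b c _ _. tri a b c" and V = V] by (simp add: T_def)
  have P: "P i j k l m = P 0 1 2 3 4"
    if "distinct [i, j, k, l, m]" "{i, j, k, l, m} \<subseteq> {..<5}" for i j k l m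
    using sum_PiE_5_permute[OF that, where c = pent and V = V] by (simp add: P_def)
  note Ts = T[of 0 1 3 2 4]
    T[of 0 1 4 2 3]
    T[of 0 2 3 1 4]
    T[of 0 2 4 1 3]
    T[of 0 3 4 1 2]
    T[of 1 2 3 0 4]
    T[of 1 2 4 0 3]
    T[of 1 3 4 0 2]
    T[of 2 3 4 0 1]
  note Ps = P[of 0 1 2 4 3]
    P[of 0 1 3 2 4]
    P[of 0 1 3 4 2]
    P[of 0 1 4 2 3]
    P[of 0 1 4 3 2]
    P[of 0 2 1 3 4]
    P[of 0 3 1 2 4]
    P[of 0 2 1 4 3]
    P[of 0 4 1 2 3]
    P[of 0 4 1 3 2]
    P[of 0 3 1 4 2]
  have "0 \<le> (\<Sum>f\<in>maps. 8 - 2 * (tri (f 0) (f 1) (f 2)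
        + tri (f 0) (f 1) (f 3)
        + tri (f 0) (f 1) (f 4)
        + tri (f 0) (f 2) (f 3)
        + tri (f 0) (f 2) (f 4)
        + tri (f 0) (f 3) (f 4)
        + tri (f 1) (f 2) (f 3)
        + tri (f 1) (f 2) (f 4)
        + tri (f 1) (f 3) (f 4)
        + tri (f 2) (f 3) (f 4))
      + (pent (f 0) (f 1) (f 2) (f 3) (f 4)
        + pent (f 0) (f 1) (f 2) (f 4) (f 3)
        + pent (f 0) (f 1) (f 3) (f 2) (f 4)
        + pent (f 0) (f 1) (f 3) (f 4) (f 2)
        + pent (f 0) (f 1) (f 4) (f 2) (f 3)
        + pent (f 0) (f 1) (f 4) (f 3) (f 2)
        + pent (f 0) (f 2) (f 1) (f 3) (f 4)
        + pent (f 0) (f 3) (f 1) (f 2) (f 4)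
        + pent (f 0) (f 2) (f 1) (f 4) (f 3)
        + pent (f 0) (f 4) (f 1) (f 2) (f 3)
        + pent (f 0) (f 4) (f 1) (f 3) (f 2)
        + pent (f 0) (f 3) (f 1) (f 4) (f 2)))"
    by (intro sum_nonneg tri_pent_pointwise)
  also have "\<dots> = 8 * N ^ 5 - 2 * (T 0 1 2 + T 0 1 3 + T 0 1 4 + T 0 2 3 + T 0 2 4 + T 0 3 4
      + T 1 2 3 + T 1 2 4 + T 1 3 4 + T 2 3 4)
      + (P 0 1 2 3 4 + P 0 1 2 4 3 + P 0 1 3 2 4 + P 0 1 3 4 2 + P 0 1 4 2 3 + P 0 1 4 3 2
          + P 0 2 1 3 4 + P 0 3 1 2 4 + P 0 2 1 4 3 + P 0 4 1 2 3 + P 0 4 1 3 2 + P 0 3 1 4 2)"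
    by (simp only: sum.distrib sum_subtractf sum_distrib_left[symmetric] T_def P_def
        sum_constant card_maps mult.commute[of _ "8::real"])
  also have "\<dots> = 8 * N ^ 5 - 20 * T 0 1 2 + 12 * P 0 1 2 3 4"
    using Ts Ps by simp
  finally show ?thesis by (simp add: T_def P_def)
qed

section \<open>Expansion over the edge subsets of the triangle and the pentagon\<close>

lemma expand_triangles:
  "(\<Sum>f\<in>maps. (1 - s (f 0) (f 1)) * (1 - s (f 1) (f 2)) * (1 - s (f 2) (f 0)))
   = N ^ 5 - 3 * (\<Sum>f\<in>maps. s (f 0) (f 1)) + 3 * (\<Sum>f\<in>maps. s (f 0) (f 1) * s (f 0) (f 2))
     - (\<Sum>f\<in>maps. tri (f 0) (f 1) (f 2))"
proof -
  define E where "E i j = (\<Sum>f\<in>maps. s (f i) (f j))" for i j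
  define C where "C i j k = (\<Sum>f\<in>maps. s (f i) (f j) * s (f i) (f k))" for i j k
  have E: "E i j = E 0 1" if "distinct [i, j, k, l, m]" "{i, j, k, l, m} \<subseteq> {..<5}" for i j k l m
    using sum_PiE_5_permute[OF that, where c = "\<lambda>a b _ _ _. s a b" and V = V] by (simp add: E_def)
  have C: "C i j k = C 0 1 2" if "distinct [i, j, k, l, m]" "{i, j, k, l, m} \<subseteq> {..<5}" for i j k l m
    using sum_PiE_5_permute[OF that, where c = "\<lambda>a b c _ _. s a b * s a c" and V = V]
    by (simp add: C_def)
  \<comment> \<open>Each pair of edges is written from its common vertex, so that its sum has the
    form \<open>C\<close>.\<close>
  have "(1 - s x y) * (1 - s y z) * (1 - s z x)
      = 1 - (s x y + s y z + s z x) + (s y x * s y z + s z y * s z x + s x z * s x y) - tri x y z" for x y z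
    by (simp add: tri_def s_sym[of y x] s_sym[of z y] s_sym[of x z] algebra_simps)
  then have "(\<Sum>f\<in>maps. (1 - s (f 0) (f 1)) * (1 - s (f 1) (f 2)) * (1 - s (f 2) (f 0)))
      = N ^ 5 - (E 0 1 + E 1 2 + E 2 0) + (C 1 0 2 + C 2 1 0 + C 0 2 1)
        - (\<Sum>f\<in>maps. tri (f 0) (f 1) (f 2))"
    by (simp only: sum.distrib sum_subtractf E_def C_def sum_constant card_maps mult_1_right)
  with E[of 1 2 0 3 4] E[of 2 0 1 3 4] C[of 1 0 2 3 4] C[of 2 1 0 3 4] C[of 0 2 1 3 4]
  show ?thesis by (simp add: E_def C_def)
qed

text \<open>Under rotation, the 32 edge subsets of the pentagon fall into the empty set, six classes
  of five, and the full cycle. The six classes are: an edge, two adjacent edges, two disjoint edges,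
  a path of three edges, an edge with a disjoint path of two, and a path of four edges.\<close>

lemma expand_pentagons:
  "(\<Sum>f\<in>maps. (1 + s (f 0) (f 1)) * (1 + s (f 1) (f 2)) * (1 + s (f 2) (f 3)) * (1 + s (f 3) (f 4))
      * (1 + s (f 4) (f 0)))
   = N ^ 5
     + 5 * (\<Sum>f\<in>maps. s (f 0) (f 1))
     + 5 * (\<Sum>f\<in>maps. s (f 0) (f 1) * s (f 0) (f 2))
     + 5 * (\<Sum>f\<in>maps. s (f 0) (f 1) * s (f 2) (f 3))
     + 5 * (\<Sum>f\<in>maps. s (f 0) (f 1) * (s (f 0) (f 2) * s (f 2) (f 3)))
     + 5 * (\<Sum>f\<in>maps. s (f 0) (f 1) * (s (f 2) (f 3) * s (f 2) (f 4)))
     + 5 * (\<Sum>f\<in>maps. (s (f 0) (f 1) * s (f 1) (f 2)) * (s (f 0) (f 3) * s (f 3) (f 4)))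
     + (\<Sum>f\<in>maps. pent (f 0) (f 1) (f 2) (f 3) (f 4))"
proof -
  define E where "E i j k l m = (\<Sum>f\<in>maps. s (f i) (f j))" for i j k l m :: nat
  define C where "C i j k l m = (\<Sum>f\<in>maps. s (f i) (f j) * s (f i) (f k))" for i j k l m :: nat
  define D where "D i j k l m = (\<Sum>f\<in>maps. s (f i) (f j) * s (f k) (f l))" for i j k l m :: nat
  define A where "A i j k l m = (\<Sum>f\<in>maps. s (f i) (f j) * (s (f i) (f k) * s (f k) (f l)))" for i j k l m :: nat
  define B where "B i j k l m = (\<Sum>f\<in>maps. s (f i) (f j) * (s (f k) (f l) * s (f k) (f m)))" for i j k l m :: nat
  define F where "F i j k l m = (\<Sum>f\<in>maps. (s (f i) (f j) * s (f j) (f k)) * (s (f i) (f l) * s (f l) (f m)))" for i j k l m :: nat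
  have E: "E i j k l m = E 0 1 2 3 4"
    if "distinct [i, j, k, l, m]" "{i, j, k, l, m} \<subseteq> {..<5}" for i j k l m
    using sum_PiE_5_permute[OF that, where c = "\<lambda>a b c d e. s a b" and V = V]
    by (simp only: E_def)
  have C: "C i j k l m = C 0 1 2 3 4"
    if "distinct [i, j, k, l, m]" "{i, j, k, l, m} \<subseteq> {..<5}" for i j k l m
    using sum_PiE_5_permute[OF that, where c = "\<lambda>a b c d e. s a b * s a c" and V = V]
    by (simp only: C_def)
  have D: "D i j k l m = D 0 1 2 3 4"
    if "distinct [i, j, k, l, m]" "{i, j, k, l, m} \<subseteq> {..<5}" for i j k l m
    using sum_PiE_5_permute[OF that, where c = "\<lambda>a b c d e. s a b * s c d" and V = V]
    by (simp only: D_def)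
  have A: "A i j k l m = A 0 1 2 3 4"
    if "distinct [i, j, k, l, m]" "{i, j, k, l, m} \<subseteq> {..<5}" for i j k l m
    using sum_PiE_5_permute[OF that, where c = "\<lambda>a b c d e. s a b * (s a c * s c d)" and V = V]
    by (simp only: A_def)
  have B: "B i j k l m = B 0 1 2 3 4"
    if "distinct [i, j, k, l, m]" "{i, j, k, l, m} \<subseteq> {..<5}" for i j k l m
    using sum_PiE_5_permute[OF that, where c = "\<lambda>a b c d e. s a b * (s c d * s c e)" and V = V]
    by (simp only: B_def)
  have F: "F i j k l m = F 0 1 2 3 4"
    if "distinct [i, j, k, l, m]" "{i, j, k, l, m} \<subseteq> {..<5}" for i j k l m
    using sum_PiE_5_permute[OF that, where c = "\<lambda>a b c d e. (s a b * s b c) * (s a d * s d e)" and V = V]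
    by (simp only: F_def)
  \<comment> \<open>Terms of one class are written from corresponding vertices, paths of four edges
    from their middle, so that each is a relabelling of one fixed pattern.\<close>
  have "(1 + s v w) * (1 + s w x) * (1 + s x y) * (1 + s y z) * (1 + s z v)
      = 1
        + (s v w + s w x + s x y + s y z + s z v)
        + (s w v * s w x + s x w * s x y + s y x * s y z + s z y * s z v + s v z * s v w)
        + (s v w * s x y + s w x * s y z + s x y * s z v + s y z * s v w + s z v * s w x)
        + (s w v * (s w x * s x y) + s x w * (s x y * s y z) + s y x * (s y z * s z v)
            + s z y * (s z v * s v w) + s v z * (s v w * s w x))
        + (s y z * (s w v * s w x) + s z v * (s x w * s x y) + s v w * (s y x * s y z)
            + s w x * (s z y * s z v) + s x y * (s v z * s v w))
        + ((s x w * s w v) * (s x y * s y z) + (s y x * s x w) * (s y z * s z v)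
            + (s z y * s y x) * (s z v * s v w) + (s v z * s z y) * (s v w * s w x)
            + (s w v * s v z) * (s w x * s x y))
        + pent v w x y z" for v w x y z
    by (simp add: pent_def s_sym[of w v] s_sym[of x w] s_sym[of y x] s_sym[of z y] s_sym[of v z] algebra_simps)
  then have "(\<Sum>f\<in>maps. (1 + s (f 0) (f 1)) * (1 + s (f 1) (f 2)) * (1 + s (f 2) (f 3)) * (1 + s (f 3) (f 4))
      * (1 + s (f 4) (f 0))) = N ^ 5
        + (E 0 1 2 3 4 + E 1 2 3 4 0 + E 2 3 4 0 1 + E 3 4 0 1 2 + E 4 0 1 2 3)
        + (C 1 0 2 3 4 + C 2 1 3 4 0 + C 3 2 4 0 1 + C 4 3 0 1 2 + C 0 4 1 2 3)
        + (D 0 1 2 3 4 + D 1 2 3 4 0 + D 2 3 4 0 1 + D 3 4 0 1 2 + D 4 0 1 2 3)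
        + (A 1 0 2 3 4 + A 2 1 3 4 0 + A 3 2 4 0 1 + A 4 3 0 1 2 + A 0 4 1 2 3)
        + (B 3 4 1 0 2 + B 4 0 2 1 3 + B 0 1 3 2 4 + B 1 2 4 3 0 + B 2 3 0 4 1)
        + (F 2 1 0 3 4 + F 3 2 1 4 0 + F 4 3 2 0 1 + F 0 4 3 1 2 + F 1 0 4 2 3)
        + (\<Sum>f\<in>maps. pent (f 0) (f 1) (f 2) (f 3) (f 4))"
    by (simp only: sum.distrib E_def C_def D_def A_def B_def F_def sum_constant card_maps mult_1_right)
  moreover note E[of 0 1 2 3 4] E[of 1 2 3 4 0] E[of 2 3 4 0 1] E[of 3 4 0 1 2] E[of 4 0 1 2 3]
    C[of 1 0 2 3 4] C[of 2 1 3 4 0] C[of 3 2 4 0 1] C[of 4 3 0 1 2] C[of 0 4 1 2 3]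
    D[of 0 1 2 3 4] D[of 1 2 3 4 0] D[of 2 3 4 0 1] D[of 3 4 0 1 2] D[of 4 0 1 2 3]
    A[of 1 0 2 3 4] A[of 2 1 3 4 0] A[of 3 2 4 0 1] A[of 4 3 0 1 2] A[of 0 4 1 2 3]
    B[of 3 4 1 0 2] B[of 4 0 2 1 3] B[of 0 1 3 2 4] B[of 1 2 4 3 0] B[of 2 3 0 4 1]
    F[of 2 1 0 3 4] F[of 3 2 1 4 0] F[of 4 3 2 0 1] F[of 0 4 3 1 2] F[of 1 0 4 2 3]
  ultimately have "(\<Sum>f\<in>maps. (1 + s (f 0) (f 1)) * (1 + s (f 1) (f 2)) * (1 + s (f 2) (f 3)) * (1 + s (f 3) (f 4))
      * (1 + s (f 4) (f 0))) = N ^ 5 + 5 * E 0 1 2 3 4 + 5 * C 0 1 2 3 4 + 5 * D 0 1 2 3 4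
          + 5 * A 0 1 2 3 4 + 5 * B 0 1 2 3 4 + 5 * F 0 1 2 3 4
        + (\<Sum>f\<in>maps. pent (f 0) (f 1) (f 2) (f 3) (f 4))"
    by simp
  then show ?thesis by (simp only: E_def C_def D_def A_def B_def F_def)
qed

text \<open>The weights 5 and 3 make the linear terms cancel, as \<open>15 * N ^ 3 * e\<close>
  occurs with both signs. Besides \<open>8 * N ^ 5\<close> and the cyclic terms, 15 times an
  expression in row sums remains; \<open>tri_pent_sum\<close> uses up
  \<open>2 * N ^ 5\<close>.\<close>

lemma triangle_pentagon_bound:
  "6 * N ^ 5
   \<le> 5 * N\<^sup>2 * (\<Sum>x\<in>V. \<Sum>y\<in>V. \<Sum>z\<in>V. (1 - s x y) * (1 - s y z) * (1 - s z x))
     + 3 * (\<Sum>v\<in>V. \<Sum>w\<in>V. \<Sum>x\<in>V. \<Sum>y\<in>V. \<Sum>z\<in>V.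
           (1 + s v w) * (1 + s w x) * (1 + s x y) * (1 + s y z) * (1 + s z v))"
proof -
  \<comment> \<open>\<open>R\<close> is a row sum and \<open>Q\<close> a signed count of walks of
    length two, so \<open>e\<close>, \<open>p\<close>, \<open>rq\<close> and \<open>qq\<close> are
    the sums over walks with one, two, three and four edges.\<close>
  define R where "R x = (\<Sum>y\<in>V. s x y)" for x
  define Q where "Q x = (\<Sum>y\<in>V. s x y * R y)" for x
  define e where "e = (\<Sum>x\<in>V. R x)"
  define p where "p = (\<Sum>x\<in>V. (R x)\<^sup>2)"
  define rq where "rq = (\<Sum>x\<in>V. R x * Q x)"
  define qq where "qq = (\<Sum>x\<in>V. (Q x)\<^sup>2)"
  \<comment> \<open>Two quarters of \<open>N\<^sup>2 * p\<close> serve to complete the two squares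
    below; the remaining \<open>3 / 2 * N\<^sup>2 * p\<close> is non-negative.\<close>
  have "0 \<le> 2 * N\<^sup>2 * p + qq + N * rq + N * e\<^sup>2 + e * p"
  proof (cases "N = 0")
    case True
    then show ?thesis
      using finite_V by (simp add: e_def p_def qq_def rq_def)
  next
    case False
    have "\<bar>R x\<bar> \<le> N" for x
      unfolding R_def by (rule order_trans[OF sum_abs]) (simp add: abs_s)
    then have "(R x)\<^sup>2 \<le> N\<^sup>2" for x
      by (metis abs_ge_zero power2_abs power_mono)
    then have "p \<le> (\<Sum>x\<in>V. N\<^sup>2)"
      unfolding p_def by (intro sum_mono)
    then have "p \<le> N ^ 3" by (simp add: power2_eq_square power3_eq_cube)
    moreover have "0 \<le> p" unfolding p_def by (intro sum_nonneg) simp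
    \<comment> \<open>This controls the square of \<open>p\<close> that arises from completing the
      square in \<open>e\<close>.\<close>
    ultimately have "p * p \<le> N ^ 3 * p" by (rule mult_right_mono)
    have "0 \<le> (\<Sum>x\<in>V. (Q x + N / 2 * R x)\<^sup>2)" by (intro sum_nonneg) simp
    also have "\<dots> = qq + N * rq + N\<^sup>2 / 4 * p"
      unfolding qq_def rq_def p_def sum_distrib_left sum.distrib[symmetric]
      by (intro sum.cong refl) (simp add: power2_eq_square algebra_simps)
    finally have 1: "0 \<le> qq + N * rq + N\<^sup>2 / 4 * p" .
    have "0 \<le> (N * e + p / 2)\<^sup>2" by simp
    also have "\<dots> = N * (N * e\<^sup>2 + e * p) + p * p / 4"
      by (simp add: power2_eq_square algebra_simps)
    also have "\<dots> \<le> N * (N * e\<^sup>2 + e * p) + N ^ 3 * p / 4"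
      using \<open>p * p \<le> N ^ 3 * p\<close> by simp
    also have "\<dots> = N * (N * e\<^sup>2 + e * p + N\<^sup>2 / 4 * p)"
      by (simp add: power2_eq_square power3_eq_cube algebra_simps)
    finally have 2: "0 \<le> N * e\<^sup>2 + e * p + N\<^sup>2 / 4 * p"
      using False by (simp add: zero_le_mult_iff)
    have "0 \<le> N\<^sup>2 * p" using \<open>0 \<le> p\<close> by simp
    with 1 2 show ?thesis by linarith
  qed
  moreover have "N\<^sup>2 * (\<Sum>x\<in>V. \<Sum>y\<in>V. \<Sum>z\<in>V. (1 - s x y) * (1 - s y z) * (1 - s z x))
      = N ^ 5 - 3 * (N ^ 3 * e) + 3 * (N\<^sup>2 * p) - (\<Sum>f\<in>maps. tri (f 0) (f 1) (f 2))"
  proof -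
    have "N\<^sup>2 * (\<Sum>x\<in>V. \<Sum>y\<in>V. \<Sum>z\<in>V. (1 - s x y) * (1 - s y z) * (1 - s z x))
      = (\<Sum>x\<in>V. \<Sum>y\<in>V. \<Sum>z\<in>V. \<Sum>_\<in>V. \<Sum>_\<in>V. (1 - s x y) * (1 - s y z) * (1 - s z x))"
      by (simp add: sum_distrib_left power2_eq_square mult.assoc)
    also have "\<dots> = (\<Sum>f\<in>maps. (1 - s (f 0) (f 1)) * (1 - s (f 1) (f 2)) * (1 - s (f 2) (f 0)))"
      by (rule sum_PiE_5[where c = "\<lambda>x y z _ _. (1 - s x y) * (1 - s y z) * (1 - s z x)", symmetric])
    finally show ?thesis
      unfolding expand_triangles
        sum_PiE_5[where c = "\<lambda>a b c d e. s a b"]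
        sum_PiE_5[where c = "\<lambda>a b c d e. s a b * s a c"] sums_via_row_sums
      by (simp add: R_def e_def p_def)
  qed
  moreover have "(\<Sum>v\<in>V. \<Sum>w\<in>V. \<Sum>x\<in>V. \<Sum>y\<in>V. \<Sum>z\<in>V.
           (1 + s v w) * (1 + s w x) * (1 + s x y) * (1 + s y z) * (1 + s z v))
      = N ^ 5 + 5 * (N ^ 3 * e) + 5 * (N\<^sup>2 * p) + 5 * (N * e\<^sup>2) + 5 * (N * rq) + 5 * (e * p)
        + 5 * qq + (\<Sum>f\<in>maps. pent (f 0) (f 1) (f 2) (f 3) (f 4))"
    using expand_pentagons
    unfolding
        sum_PiE_5[where c = "\<lambda>v w x y z. (1 + s v w) * (1 + s w x) * (1 + s x y) * (1 + s y z) * (1 + s z v)"]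
        sum_PiE_5[where c = "\<lambda>a b c d e. s a b"]
        sum_PiE_5[where c = "\<lambda>a b c d e. s a b * s a c"]
        sum_PiE_5[where c = "\<lambda>a b c d e. s a b * s c d"]
        sum_PiE_5[where c = "\<lambda>a b c d e. s a b * (s a c * s c d)"]
        sum_PiE_5[where c = "\<lambda>a b c d e. s a b * (s c d * s c e)"]
        sum_PiE_5[where c = "\<lambda>a b c d e. (s a b * s b c) * (s a d * s d e)"]
        sums_via_row_sums
    by (simp add: R_def Q_def e_def p_def rq_def qq_def)
  moreover note tri_pent_sum
  ultimately show ?thesis by (simp add: algebra_simps)
qed

end

section \<open>Homomorphism densities\<close>

lemma hom_density_complete_graph_3:
  assumes "pair_graph G"
  shows "hom_density (complete_graph 3) G
    = (\<Sum>x\<in>pverts G. \<Sum>y\<in>pverts G. \<Sum>z\<in>pverts G. of_bool ((x, y) \<in> parcs G)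
        * of_bool ((y, z) \<in> parcs G) * of_bool ((z, x) \<in> parcs G)) / real (card (pverts G)) ^ 3"
proof -
  interpret pair_graph G by fact
  have sym: "(v, u) \<in> parcs G" if "(u, v) \<in> parcs G" for u v
    using that pair_sym_arcs by (auto simp: symmetric_def dest: symD)
  have three: "{..<3::nat} = {0, 1, 2}" by auto
  have arcs: "parcs (complete_graph 3) = {(0, 1), (1, 0), (1, 2), (2, 1), (0, 2), (2, 0)}"
    unfolding complete_graph_def three by auto
  \<comment> \<open>By symmetry of \<open>G\<close>, one arc per edge suffices; the indices run
    downwards to fit \<open>sum_PiE_3\<close>.\<close>
  have homs: "graph_homs (complete_graph 3) G = ({..<3} \<rightarrow>\<^sub>E pverts G) \<inter>
      {f. (f 2, f 1) \<in> parcs G \<and> (f 1, f 0) \<in> parcs G \<and> (f 0, f 2) \<in> parcs G}"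
    unfolding graph_homs_def arcs by (auto simp: complete_graph_def intro: sym)
  have "finite ({..<3::nat} \<rightarrow>\<^sub>E pverts G)"
    by (intro finite_PiE) simp_all
  then have "real (card (graph_homs (complete_graph 3) G)) =
      (\<Sum>f\<in>{..<3::nat} \<rightarrow>\<^sub>E pverts G. of_bool ((f 2, f 1) \<in> parcs G)
         * of_bool ((f 1, f 0) \<in> parcs G) * of_bool ((f 0, f 2) \<in> parcs G))"
    by (simp add: homs sum_of_bool_eq of_bool_conj[symmetric] conj_assoc)
  also have "\<dots> = (\<Sum>x\<in>pverts G. \<Sum>y\<in>pverts G. \<Sum>z\<in>pverts G. of_bool ((x, y) \<in> parcs G)
        * of_bool ((y, z) \<in> parcs G) * of_bool ((z, x) \<in> parcs G))"
    by (rule sum_PiE_3)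
  finally show ?thesis
    by (simp add: hom_density_def complete_graph_def)
qed

lemma hom_density_cycle_graph_5:
  assumes "pair_graph G"
  shows "hom_density (cycle_graph 5) G
    = (\<Sum>v\<in>pverts G. \<Sum>w\<in>pverts G. \<Sum>x\<in>pverts G. \<Sum>y\<in>pverts G. \<Sum>z\<in>pverts G.
        of_bool ((v, w) \<in> parcs G) * of_bool ((w, x) \<in> parcs G) * of_bool ((x, y) \<in> parcs G)
        * of_bool ((y, z) \<in> parcs G) * of_bool ((z, v) \<in> parcs G)) / real (card (pverts G)) ^ 5"
proof -
  interpret pair_graph G by fact
  have sym: "(v, u) \<in> parcs G" if "(u, v) \<in> parcs G" for u v
    using that pair_sym_arcs by (auto simp: symmetric_def dest: symD)
  have homs: "graph_homs (cycle_graph 5) G = ({..<5} \<rightarrow>\<^sub>E pverts G) \<inter>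
      {f. (f 0, f 1) \<in> parcs G \<and> (f 1, f 2) \<in> parcs G \<and> (f 2, f 3) \<in> parcs G
        \<and> (f 3, f 4) \<in> parcs G \<and> (f 4, f 0) \<in> parcs G}"
  proof -
    have verts: "pverts (cycle_graph 5) = {..<5}"
      by (simp add: cycle_graph_def)
    have five: "(\<forall>u<5. P u) \<longleftrightarrow> P 0 \<and> P 1 \<and> P 2 \<and> P 3 \<and> P (4::nat)" for P
      by (simp add: numeral_eq_Suc All_less_Suc) blast
    \<comment> \<open>By symmetry of \<open>G\<close>, it suffices to test the arcs that go forward
      around the cycle.\<close>
    have "(\<forall>(u, v)\<in>parcs (cycle_graph 5). (f u, f v) \<in> parcs G)
        \<longleftrightarrow> (\<forall>u<5. (f u, f (Suc u mod 5)) \<in> parcs G)" for f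
    proof (intro iffI allI impI ballI)
      fix u :: nat assume "u < 5"
      then have "(u, Suc u mod 5) \<in> parcs (cycle_graph 5)"
        by (simp add: cycle_graph_def)
      moreover assume "\<forall>(u, v)\<in>parcs (cycle_graph 5). (f u, f v) \<in> parcs G"
      ultimately show "(f u, f (Suc u mod 5)) \<in> parcs G" by fast
    next
      fix e assume "\<forall>u<5. (f u, f (Suc u mod 5)) \<in> parcs G" "e \<in> parcs (cycle_graph 5)"
      then show "case e of (u, v) \<Rightarrow> (f u, f v) \<in> parcs G"
        using sym by (auto simp: cycle_graph_def)
    qed
    also have "(\<forall>u<5. (f u, f (Suc u mod 5)) \<in> parcs G) \<longleftrightarrow>
        (f 0, f 1) \<in> parcs G \<and> (f 1, f 2) \<in> parcs G \<and> (f 2, f 3) \<in> parcs G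
        \<and> (f 3, f 4) \<in> parcs G \<and> (f 4, f 0) \<in> parcs G" for f
      unfolding five by (simp add: numeral_2_eq_2)
    finally show ?thesis
      unfolding graph_homs_def verts by blast
  qed
  have "finite ({..<5::nat} \<rightarrow>\<^sub>E pverts G)"
    by (intro finite_PiE) simp_all
  then have "real (card (graph_homs (cycle_graph 5) G)) =
      (\<Sum>f\<in>{..<5::nat} \<rightarrow>\<^sub>E pverts G. of_bool ((f 0, f 1) \<in> parcs G) * of_bool ((f 1, f 2) \<in> parcs G)
         * of_bool ((f 2, f 3) \<in> parcs G) * of_bool ((f 3, f 4) \<in> parcs G)
         * of_bool ((f 4, f 0) \<in> parcs G))"
    by (simp add: homs sum_of_bool_eq of_bool_conj[symmetric] conj_assoc)
  also have "\<dots> = (\<Sum>v\<in>pverts G. \<Sum>w\<in>pverts G. \<Sum>x\<in>pverts G. \<Sum>y\<in>pverts G. \<Sum>z\<in>pverts G.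
        of_bool ((v, w) \<in> parcs G) * of_bool ((w, x) \<in> parcs G) * of_bool ((x, y) \<in> parcs G)
        * of_bool ((y, z) \<in> parcs G) * of_bool ((z, v) \<in> parcs G))"
    by (rule sum_PiE_5)
  finally show ?thesis
    by (simp add: hom_density_def cycle_graph_def)
qed

text \<open>Replacing signs by indicators brings in the factors 8 and 32. Dividing by
  \<open>68 * N ^ 5\<close> then turns the weights 5 * 8 and 3 * 32 into 10/17 and 24/17, and the
  diagonal error 96 * 5 \<open>N ^ 4\<close> into \<open>120 / 17 / N\<close>.\<close>

lemma density_lower_bound:
  assumes "pair_graph G" "pverts G \<noteq> {}"
  shows "3 / 34 - 120 / 17 / real (card (pverts G))
    \<le> 10 / 17 * hom_density (complete_graph 3) G
      + (2 - 10 / 17) * hom_density (cycle_graph 5) (graph_complement G)"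
proof -
  interpret pair_graph G by fact
  define V where "V = pverts G"
  define N where "N = real (card V)"
  have fin: "finite V" by (simp add: V_def)
  then have "0 < N" using assms(2) by (simp add: N_def V_def card_gt_0_iff)
  define a :: "'a \<Rightarrow> 'a \<Rightarrow> real" where "a x y = of_bool ((x, y) \<in> parcs G)" for x y
  define w :: "'a \<Rightarrow> 'a \<Rightarrow> real" where "w x y = of_bool ((x, y) \<notin> parcs G)" for x y
  define w' :: "'a \<Rightarrow> 'a \<Rightarrow> real" where "w' x y = of_bool ((x, y) \<in> parcs (graph_complement G))" for x y
  define d :: "'a \<Rightarrow> 'a \<Rightarrow> real" where "d x y = of_bool (x = y)" for x y
  define X where "X = (\<Sum>x\<in>V. \<Sum>y\<in>V. \<Sum>z\<in>V. a x y * a y z * a z x)"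
  define Y where "Y = (\<Sum>p\<in>V. \<Sum>q\<in>V. \<Sum>x\<in>V. \<Sum>y\<in>V. \<Sum>z\<in>V.
     w p q * w q x * w x y * w y z * w z p)"
  define Y' where "Y' = (\<Sum>p\<in>V. \<Sum>q\<in>V. \<Sum>x\<in>V. \<Sum>y\<in>V. \<Sum>z\<in>V.
     w' p q * w' q x * w' x y * w' y z * w' z p)"
  \<comment> \<open>The diagonal counts as non-adjacent; this affects at most \<open>5 N\<^sup>4\<close> of the 5-tuples.\<close>
  define s :: "'a \<Rightarrow> 'a \<Rightarrow> real" where "s x y = w x y - a x y" for x y
  have s: "1 - s x y = 2 * a x y" "1 + s x y = 2 * w x y" for x y
    by (simp_all add: s_def w_def a_def)
  interpret sign_kernel V s
  proof
    show "\<bar>s x y\<bar> = 1" for x y by (simp add: s_def w_def a_def)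
    have "(x, y) \<in> parcs G \<longleftrightarrow> (y, x) \<in> parcs G" for x y
      using pair_sym_arcs by (auto simp: symmetric_def dest: symD)
    then show "s x y = s y x" for x y by (simp add: s_def w_def a_def)
  qed (rule fin)
  have "(\<Sum>x\<in>V. \<Sum>y\<in>V. \<Sum>z\<in>V. (1 - s x y) * (1 - s y z) * (1 - s z x)) = 8 * X"
    unfolding s X_def by (simp add: sum_distrib_left mult_ac)
  moreover have "(\<Sum>p\<in>V. \<Sum>q\<in>V. \<Sum>x\<in>V. \<Sum>y\<in>V. \<Sum>z\<in>V.
      (1 + s p q) * (1 + s q x) * (1 + s x y) * (1 + s y z) * (1 + s z p)) = 32 * Y"
    unfolding s Y_def by (simp add: sum_distrib_left mult_ac)
  ultimately have main: "6 * N ^ 5 \<le> 40 * N\<^sup>2 * X + 96 * Y"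
    using triangle_pentagon_bound by (simp add: N_def)
  \<comment> \<open>A tuple with equal cyclic neighbours is charged to the five diagonal terms; on
    all others \<open>w\<close> and \<open>w'\<close> agree along the cycle.\<close>
  have w: "w p q * w q x * w x y * w y z * w z p
      \<le> w' p q * w' q x * w' x y * w' y z * w' z p + (d p q + d q x + d x y + d y z + d z p)"
    if "p \<in> V" "q \<in> V" "x \<in> V" "y \<in> V" "z \<in> V" for p q x y z
  proof (cases "p = q \<or> q = x \<or> x = y \<or> y = z \<or> z = p")
    case True
    have "w p q * w q x * w x y * w y z * w z p \<le> 1"
      by (simp add: w_def flip: of_bool_conj)
    also have "1 \<le> d p q + d q x + d x y + d y z + d z p"
      using True by (auto simp: d_def)
    also have "\<dots> \<le> w' p q * w' q x * w' x y * w' y z * w' z p + \<dots>"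
      by (simp add: w'_def)
    finally show ?thesis .
  next
    case False
    then show ?thesis
      using that by (simp add: w_def w'_def d_def V_def graph_complement_def)
  qed
  have d: "(\<Sum>y\<in>V. d x y) = 1" "(\<Sum>y\<in>V. d y x) = 1" if "x \<in> V" for x
    using that fin by (simp_all add: d_def of_bool_def)
  have "Y \<le> (\<Sum>p\<in>V. \<Sum>q\<in>V. \<Sum>x\<in>V. \<Sum>y\<in>V. \<Sum>z\<in>V.
      w' p q * w' q x * w' x y * w' y z * w' z p + (d p q + d q x + d x y + d y z + d z p))"
    unfolding Y_def by (intro sum_mono w)
  also have "\<dots> = Y' + 5 * N ^ 4"
    unfolding Y'_def sum.distrib
    by (simp add: d N_def power4_eq_xxxx flip: sum_distrib_left)
  finally have "6 * N ^ 5 - 480 * N ^ 4 \<le> 40 * N\<^sup>2 * X + 96 * Y'"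
    using main by simp
  then have "(6 * N ^ 5 - 480 * N ^ 4) / (68 * N ^ 5) \<le> (40 * N\<^sup>2 * X + 96 * Y') / (68 * N ^ 5)"
    using \<open>0 < N\<close> by (intro divide_right_mono) simp_all
  also have "(6 * N ^ 5 - 480 * N ^ 4) / (68 * N ^ 5) = 3 / 34 - 120 / 17 / N"
    using \<open>0 < N\<close> by (simp add: field_simps eval_nat_numeral)
  also have "(40 * N\<^sup>2 * X + 96 * Y') / (68 * N ^ 5) = 10 / 17 * (X / N ^ 3) + (2 - 10 / 17) * (Y' / N ^ 5)"
    using \<open>0 < N\<close> by (simp add: field_simps eval_nat_numeral)
  finally show ?thesis
    unfolding hom_density_complete_graph_3[OF assms(1)]
      hom_density_cycle_graph_5[OF pair_graph_complement[OF assms(1)]]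
    by (simp add: X_def Y'_def N_def V_def a_def w'_def graph_complement_def)
qed

section \<open>Densities of blow-ups\<close>

lemma sum_mod:
  fixes f :: "nat \<Rightarrow> real"
  shows "(\<Sum>v<m * k. f (v mod m)) = real k * (\<Sum>r<m. f r)"
proof (induction k)
  case (Suc k)
  have "(\<Sum>v<m * Suc k. f (v mod m))
      = (\<Sum>v<m * k. f (v mod m)) + (\<Sum>v = m * k..<m * k + m. f (v mod m))"
    using sum.atLeastLessThan_concat[of 0 "m * k" "m * k + m" "\<lambda>v. f (v mod m)"]
    by (simp add: lessThan_atLeast0 add.commute)
  also have "(\<Sum>v = m * k..<m * k + m. f (v mod m)) = (\<Sum>r<m. f ((r + m * k) mod m))"
    using sum.shift_bounds_nat_ivl[of "\<lambda>v. f (v mod m)" 0 "m * k" m]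
    by (simp add: lessThan_atLeast0 add.commute)
  finally show ?case
    using Suc by (simp add: algebra_simps)
qed simp

lemma sum_mod_3:
  fixes g :: "nat \<Rightarrow> nat \<Rightarrow> nat \<Rightarrow> real"
  shows "(\<Sum>x<m * k. \<Sum>y<m * k. \<Sum>z<m * k. g (x mod m) (y mod m) (z mod m))
    = real k ^ 3 * (\<Sum>x<m. \<Sum>y<m. \<Sum>z<m. g x y z)"
  unfolding sum_mod[of "\<lambda>z. g (x mod m) (y mod m) z" for x y]
    sum_mod[of "\<lambda>y. real k * (\<Sum>z<m. g (x mod m) y z)" for x]
    sum_mod[of "\<lambda>x. real k * (\<Sum>y<m. real k * (\<Sum>z<m. g x y z))"]
  by (simp add: sum_distrib_left[symmetric] power3_eq_cube)

lemma sum_mod_5: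
  fixes g :: "nat \<Rightarrow> nat \<Rightarrow> nat \<Rightarrow> nat \<Rightarrow> nat \<Rightarrow> real"
  shows "(\<Sum>v<m * k. \<Sum>w<m * k. \<Sum>x<m * k. \<Sum>y<m * k. \<Sum>z<m * k.
        g (v mod m) (w mod m) (x mod m) (y mod m) (z mod m))
    = real k ^ 5 * (\<Sum>v<m. \<Sum>w<m. \<Sum>x<m. \<Sum>y<m. \<Sum>z<m. g v w x y z)"
  unfolding sum_mod_3[of "\<lambda>x y z. g (v mod m) (w mod m) x y z" for v w]
    sum_mod[of "\<lambda>w. real k ^ 3 * (\<Sum>x<m. \<Sum>y<m. \<Sum>z<m. g (v mod m) w x y z)" for v]
    sum_mod[of "\<lambda>v. real k * (\<Sum>w<m. real k ^ 3 * (\<Sum>x<m. \<Sum>y<m. \<Sum>z<m. g v w x y z))"]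
  by (simp add: sum_distrib_left[symmetric] eval_nat_numeral)

text \<open>Vertices are sorted by residue modulo \<open>m\<close>. Each of the \<open>m\<close>
  parts has exactly \<open>k\<close> elements, so sums over the vertices reduce to sums over the
  pattern.\<close>

definition blow_up :: "(nat \<Rightarrow> nat \<Rightarrow> bool) \<Rightarrow> nat \<Rightarrow> nat \<Rightarrow> nat pair_pre_digraph" where
  "blow_up A m k = \<lparr> pverts = {..<m * k},
     parcs = {(u, v) \<in> {..<m * k} \<times> {..<m * k}. A (u mod m) (v mod m)} \<rparr>"

lemma pair_graph_blow_up:
  assumes "\<And>u v. u < m \<Longrightarrow> v < m \<Longrightarrow> A u v \<Longrightarrow> A v u" "\<And>u. u < m \<Longrightarrow> \<not> A u u" "m > 0"
  shows "pair_graph (blow_up A m k)"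
  using assms by (intro pair_graphI) (auto simp: blow_up_def)

lemma hom_density_complete_graph_3_blow_up:
  assumes "pair_graph (blow_up A m k)" "k > 0"
  shows "hom_density (complete_graph 3) (blow_up A m k)
    = (\<Sum>x<m. \<Sum>y<m. \<Sum>z<m. of_bool (A x y) * of_bool (A y z) * of_bool (A z x)) / real m ^ 3"
  using \<open>k > 0\<close>
    sum_mod_3[where m = m and k = k and g = "\<lambda>x y z. of_bool (A x y) * of_bool (A y z) * of_bool (A z x)"]
  unfolding hom_density_complete_graph_3[OF assms(1)]
  by (simp add: blow_up_def power_mult_distrib)

text \<open>Equality can fail: the pattern sum also counts tuples with equal consecutive vertices,
  where \<open>A\<close> is false although the complement has no loop.\<close>

lemma hom_density_cycle_graph_5_blow_up:
  assumes "pair_graph (blow_up A m k)" "k > 0"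
  shows "hom_density (cycle_graph 5) (graph_complement (blow_up A m k))
    \<le> (\<Sum>v<m. \<Sum>w<m. \<Sum>x<m. \<Sum>y<m. \<Sum>z<m. of_bool (\<not> A v w) * of_bool (\<not> A w x)
         * of_bool (\<not> A x y) * of_bool (\<not> A y z) * of_bool (\<not> A z v)) / real m ^ 5"
proof -
  define b :: "nat \<Rightarrow> nat \<Rightarrow> real" where "b x y = of_bool (\<not> A x y)" for x y
  have "hom_density (cycle_graph 5) (graph_complement (blow_up A m k))
      \<le> (\<Sum>v<m * k. \<Sum>w<m * k. \<Sum>x<m * k. \<Sum>y<m * k. \<Sum>z<m * k. b (v mod m) (w mod m)
          * b (w mod m) (x mod m) * b (x mod m) (y mod m) * b (y mod m) (z mod m)
          * b (z mod m) (v mod m)) / real (m * k) ^ 5"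
    unfolding hom_density_cycle_graph_5[OF pair_graph_complement[OF assms(1)]]
    unfolding graph_complement_def blow_up_def b_def pair_pre_digraph.simps card_lessThan
    by (intro divide_right_mono sum_mono mult_mono) auto
  also have "\<dots> = (\<Sum>v<m. \<Sum>w<m. \<Sum>x<m. \<Sum>y<m. \<Sum>z<m.
      b v w * b w x * b x y * b y z * b z v) / real m ^ 5"
    using \<open>k > 0\<close>
    unfolding sum_mod_5[where m = m and k = k and g = "\<lambda>v w x y z. b v w * b w x * b x y * b y z * b z v"]
    by (simp add: power_mult_distrib)
  finally show ?thesis by (simp add: b_def)
qed

section \<open>Extremal graphs\<close>

text \<open>
  For \<open>u, v < 6\<close> this is the complement of a hexagon; the summand 6 avoids truncated subtraction.
\<close>
definition prism :: "nat \<Rightarrow> nat \<Rightarrow> bool" where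
  "prism u v \<longleftrightarrow> (6 + v - u) mod 6 \<in> {2, 3, 4}"

lemma all_less_6: "(\<forall>u<6. P u) \<longleftrightarrow> P 0 \<and> P 1 \<and> P 2 \<and> P 3 \<and> P 4 \<and> P (5::nat)"
  by (simp add: numeral_eq_Suc All_less_Suc) blast

lemma prism_sym: "u < 6 \<Longrightarrow> v < 6 \<Longrightarrow> prism u v \<Longrightarrow> prism v u"
proof -
  have "\<forall>u<6. \<forall>v<6. prism u v \<longrightarrow> prism v u"
    unfolding all_less_6 by (simp add: prism_def)
  then show "u < 6 \<Longrightarrow> v < 6 \<Longrightarrow> prism u v \<Longrightarrow> prism v u" by blast
qed

text \<open>The sums are the traces of the third power of the prism matrix and of the fifth power of
  the looped hexagon matrix. Both matrices are circulant, so a trace is 6 times one diagonal entry,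
  here 2 and 51.\<close>

lemma prism_walks:
  shows "(\<Sum>x<6. \<Sum>y<6. \<Sum>z<6. of_bool (prism x y) * of_bool (prism y z)
      * of_bool (prism z x)) = (12 :: real)"
    and "(\<Sum>v<6. \<Sum>w<6. \<Sum>x<6. \<Sum>y<6. \<Sum>z<6. of_bool (\<not> prism v w) * of_bool (\<not> prism w x)
      * of_bool (\<not> prism x y) * of_bool (\<not> prism y z) * of_bool (\<not> prism z v)) = (306 :: real)"
proof -
  define B where "B u v = (of_bool (prism u v) :: real)" for u v
  define W where "W u v = (of_bool (\<not> prism u v) :: real)" for u v
  define t where "t l u v = (l ! ((6 + v - u) mod 6) :: real)" for l and u v :: nat
  have sum6: "(\<Sum>z<6. g z) = g 0 + g 1 + g 2 + g 3 + g 4 + g (5::nat)" for g :: "nat \<Rightarrow> real"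
    by (simp add: numeral_eq_Suc)
  \<comment> \<open>\<open>t l\<close> is the circulant matrix with first row \<open>l\<close>; the lists below are first rows of powers
    of the adjacency matrices of the prism and of the looped hexagon.\<close>
  have 1: "\<forall>y<6. \<forall>x<6. (\<Sum>z<6. B y z * B z x) = t [3, 2, 1, 0, 1, 2] y x"
    unfolding all_less_6 sum6 by (intro conjI; simp add: B_def prism_def t_def)
  have 0: "\<forall>x<6. (\<Sum>y<6. B x y * t [3, 2, 1, 0, 1, 2] y x) = 2"
    unfolding all_less_6 sum6 by (intro conjI; simp add: B_def prism_def t_def)
  have "(\<Sum>x<6. \<Sum>y<6. \<Sum>z<6. B x y * B y z * B z x)
      = (\<Sum>x<6. \<Sum>y<6. B x y * (\<Sum>z<6. B y z * B z x))"
    by (simp only: sum_distrib_left mult.assoc)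
  also have "\<dots> = (\<Sum>x<6::nat. 2)"
    using 0 1 by (simp cong: sum.cong_simp)
  finally show "(\<Sum>x<6. \<Sum>y<6. \<Sum>z<6. of_bool (prism x y) * of_bool (prism y z) * of_bool (prism z x)) = (12 :: real)"
    by (simp add: B_def)
  \<comment> \<open>The square is the same as for the prism: the two circulants differ by a shift by
    3, which squaring turns into a shift by 6.\<close>
  have 2: "\<forall>y<6. \<forall>v<6. (\<Sum>z<6. W y z * W z v) = t [3, 2, 1, 0, 1, 2] y v"
    unfolding all_less_6 sum6 by (intro conjI; simp add: W_def prism_def t_def)
  have 3: "\<forall>x<6. \<forall>v<6. (\<Sum>y<6. W x y * t [3, 2, 1, 0, 1, 2] y v) = t [7, 6, 3, 2, 3, 6] x v"
    unfolding all_less_6 sum6 by (intro conjI; simp add: W_def prism_def t_def)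
  have 4: "\<forall>w<6. \<forall>v<6. (\<Sum>x<6. W w x * t [7, 6, 3, 2, 3, 6] x v) = t [19, 16, 11, 8, 11, 16] w v"
    unfolding all_less_6 sum6 by (intro conjI; simp add: W_def prism_def t_def)
  have 5: "\<forall>v<6. (\<Sum>w<6. W v w * t [19, 16, 11, 8, 11, 16] w v) = 51"
    unfolding all_less_6 sum6 by (intro conjI; simp add: W_def prism_def t_def)
  have "(\<Sum>v<6. \<Sum>w<6. \<Sum>x<6. \<Sum>y<6. \<Sum>z<6. W v w * W w x * W x y * W y z * W z v)
      = (\<Sum>v<6. \<Sum>w<6. W v w * (\<Sum>x<6. W w x * (\<Sum>y<6. W x y * (\<Sum>z<6. W y z * W z v))))"
    by (simp only: sum_distrib_left mult.assoc)
  also have "\<dots> = (\<Sum>v<6::nat. 51)"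
    using 2 3 4 5 by (simp cong: sum.cong_simp)
  finally show "(\<Sum>v<6. \<Sum>w<6. \<Sum>x<6. \<Sum>y<6. \<Sum>z<6. of_bool (\<not> prism v w) * of_bool (\<not> prism w x)
         * of_bool (\<not> prism x y) * of_bool (\<not> prism y z) * of_bool (\<not> prism z v)) = (306 :: real)"
    by (simp add: W_def)
qed

section \<open>Enumerations of the finite graphs\<close>

definition density_value :: "real \<Rightarrow> 'a pair_pre_digraph \<Rightarrow> real" where
  "density_value l G = l * hom_density (complete_graph 3) G
     + (2 - l) * hom_density (cycle_graph 5) (graph_complement G)"

lemma c_weighted_density_value:
  "c_weighted G l (complete_graph 3) (cycle_graph 5) = liminf (\<lambda>n. ereal (density_value l (G n)))"
  by (simp add: c_weighted_def density_value_def)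

lemma pverts_graph_complement: "pverts (graph_complement G) = pverts G"
  by (simp add: graph_complement_def)

text \<open>An enumeration contains a given graph only up to isomorphism, so values computed for a
  blow-up must be carried over to its copy.\<close>

lemma density_value_iso:
  assumes "pair_graph G" "pair_graph H" "digraph_iso (with_proj G) (with_proj H)"
  shows "density_value l H = density_value l G"
proof -
  interpret G: pair_graph G by fact
  obtain f where f: "bij_betw f (pverts G) (pverts H)" "parcs H = map_prod f f ` parcs G"
    using assms digraph_iso_pair_iff by blast
  have arcs: "(f x, f y) \<in> parcs H \<longleftrightarrow> (x, y) \<in> parcs G" if "x \<in> pverts G" "y \<in> pverts G" for x y
  proof
    assume "(f x, f y) \<in> parcs H"
    then obtain u v where "(u, v) \<in> parcs G" "f u = f x" "f v = f y"
      unfolding f(2) by auto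
    moreover from this have "u \<in> pverts G" "v \<in> pverts G"
      using G.in_arcsD1 G.in_arcsD2 by auto
    ultimately show "(x, y) \<in> parcs G"
      using that bij_betw_imp_inj_on[OF f(1)] by (auto dest: inj_onD)
  qed (auto simp: f(2))
  have arcs': "(f x, f y) \<in> parcs (graph_complement H) \<longleftrightarrow> (x, y) \<in> parcs (graph_complement G)"
    if "x \<in> pverts G" "y \<in> pverts G" for x y
    using arcs[OF that] that bij_betwE[OF f(1)] inj_on_eq_iff[OF bij_betw_imp_inj_on[OF f(1)] that]
    by (auto simp: graph_complement_def)
  have sums: "(\<Sum>x\<in>pverts H. g x) = (\<Sum>x\<in>pverts G. g (f x))" for g :: "'b \<Rightarrow> real"
    by (rule sum.reindex_bij_betw[OF f(1), symmetric])
  note card = bij_betw_same_card[OF f(1), symmetric]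
  have "hom_density (complete_graph 3) H = hom_density (complete_graph 3) G"
    unfolding hom_density_complete_graph_3[OF assms(1)] hom_density_complete_graph_3[OF assms(2)]
      sums card
    by (intro arg_cong2[of _ _ _ _ "(/)"] sum.cong refl) (simp only: arcs)
  moreover have "hom_density (cycle_graph 5) (graph_complement H)
      = hom_density (cycle_graph 5) (graph_complement G)"
    unfolding hom_density_cycle_graph_5[OF pair_graph_complement[OF assms(1)]]
      hom_density_cycle_graph_5[OF pair_graph_complement[OF assms(2)]]
      pverts_graph_complement sums card
    by (intro arg_cong2[of _ _ _ _ "(/)"] sum.cong refl) (simp only: arcs')
  ultimately show ?thesis by (simp add: density_value_def)
qed

text \<open>Graphs with at most \<open>K\<close> vertices form finitely many isomorphism classes,
  each listed once. This makes the error term of the lower bound vanish in the limit.\<close>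

lemma finite_card_le_enumeration:
  assumes "enumerates_finite_graphs G"
  shows "finite {n. card (pverts (G n)) \<le> K}"
proof -
  define iso where "iso H n \<longleftrightarrow> digraph_iso (with_proj H) (with_proj (G n))" for H :: "nat pair_pre_digraph" and n
  have H: "\<exists>!n. iso H n" if "pair_graph H" for H
    using assms that unfolding enumerates_finite_graphs_def iso_def by simp
  \<comment> \<open>Every graph with at most \<open>K\<close> vertices has a copy in this finite
    family. Not all members are graphs, hence the condition \<open>pair_graph H\<close>
    below.\<close>
  define \<H> where "\<H> = (\<lambda>(A, B). \<lparr>pverts = A, parcs = B\<rparr>) ` (Pow {..<K} \<times> Pow ({..<K} \<times> {..<K}))"
  have "\<exists>H\<in>\<H>. pair_graph H \<and> iso H n" if "card (pverts (G n)) \<le> K" for n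
  proof -
    interpret pair_graph "G n" using assms by (simp add: enumerates_finite_graphs_def)
    define c where "c = card (pverts (G n))"
    obtain g where g: "bij_betw g {..<c} (pverts (G n))"
      using ex_bij_betw_nat_finite[OF pair_finite_verts] by (auto simp: c_def lessThan_atLeast0)
    define H where "H = \<lparr>pverts = {..<c}, parcs = {(u, v) \<in> {..<c} \<times> {..<c}. (g u, g v) \<in> parcs (G n)}\<rparr>"
    have "pair_graph H"
      using pair_sym_arcs pair_no_loops[of "(x, x)" for x]
      by (intro pair_graphI) (auto simp: H_def symmetric_def dest: symD)
    moreover have "parcs (G n) = map_prod g g ` parcs H"
    proof (intro equalityI subsetI)
      fix e assume e: "e \<in> parcs (G n)"
      then have "fst e \<in> g ` {..<c}" "snd e \<in> g ` {..<c}"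
        using g in_arcsD1 in_arcsD2 by (auto simp: bij_betw_def)
      then obtain u v where "u < c" "v < c" "e = map_prod g g (u, v)"
        by (cases e) auto
      with e show "e \<in> map_prod g g ` parcs H"
        by (intro image_eqI[of _ _ "(u, v)"]) (auto simp: H_def)
    qed (auto simp: H_def)
    moreover have "pverts H = {..<c}" by (simp add: H_def)
    ultimately have "iso H n"
      unfolding iso_def using g digraph_iso_pair_iff[OF _ pair_graph_axioms] by metis
    moreover have "H \<in> \<H>"
      using that unfolding \<H>_def H_def c_def
      by (intro image_eqI[of _ _ "({..<c}, parcs H)"]) (auto simp: H_def c_def)
    ultimately show ?thesis using \<open>pair_graph H\<close> by blast
  qed
  then obtain h where h: "h n \<in> \<H>" "pair_graph (h n)" "iso (h n) n" if "card (pverts (G n)) \<le> K" for n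
    by metis
  \<comment> \<open>A graph isomorphic to two entries would contradict uniqueness in the
    enumeration.\<close>
  have "inj_on h {n. card (pverts (G n)) \<le> K}"
    using h H by (intro inj_onI) (metis mem_Collect_eq)
  moreover have "finite \<H>" unfolding \<H>_def by simp
  then have "finite (h ` {n. card (pverts (G n)) \<le> K})"
    by (rule finite_subset[rotated]) (use h in auto)
  ultimately show ?thesis
    by (rule finite_imageD[rotated])
qed

text \<open>Copies of the blow-ups occur at infinitely many positions of the enumeration, and a
  limes inferior cannot exceed a bound that is met infinitely often.\<close>

lemma c_weighted_le:
  assumes "enumerates_finite_graphs G" "m > 0"
    and pg: "\<And>k. k > 0 \<Longrightarrow> pair_graph (blow_up A m k)"
    and le: "\<And>k. k > 0 \<Longrightarrow> density_value l (blow_up A m k) \<le> B"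
  shows "c_weighted G l (complete_graph 3) (cycle_graph 5) \<le> ereal B"
proof -
  have G: "pair_graph (G n)" for n
    using assms(1) by (simp add: enumerates_finite_graphs_def)
  have "\<exists>n. digraph_iso (with_proj (blow_up A m k)) (with_proj (G n))" if "k > 0" for k
    using assms(1) pg[OF that] unfolding enumerates_finite_graphs_def by blast
  then obtain n where iso: "digraph_iso (with_proj (blow_up A m k)) (with_proj (G (n k)))" if "k > 0" for k
    by metis
  have card: "card (pverts (G (n k))) = m * k" if "k > 0" for k
    using iso[OF that] digraph_iso_pair_iff[OF pg[OF that] G]
    by (auto dest!: bij_betw_same_card simp: blow_up_def)
  \<comment> \<open>Different \<open>k\<close> give different numbers of vertices, hence different
    positions.\<close>
  have "inj_on n {0<..}"
    using card \<open>m > 0\<close> by (intro inj_onI) (metis greaterThan_iff mult_left_cancel neq0_conv)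
  then have "infinite (n ` {0<..})"
    by (simp add: finite_image_iff infinite_Ioi)
  show ?thesis
  proof (rule ccontr)
    assume "\<not> ?thesis"
    then have "eventually (\<lambda>j. ereal B < ereal (density_value l (G j))) sequentially"
      unfolding c_weighted_density_value by (intro less_LiminfD) simp
    then obtain M where M: "B < density_value l (G j)" if "j \<ge> M" for j
      by (auto simp: eventually_sequentially)
    obtain j where "j \<in> n ` {0<..}" "j \<ge> M"
      using \<open>infinite (n ` {0<..})\<close> by (meson infinite_nat_iff_unbounded_le)
    then obtain k where "k > 0" "B < density_value l (G (n k))"
      using M by auto
    then show False
      using le[OF \<open>k > 0\<close>] density_value_iso[OF pg[OF \<open>k > 0\<close>] G iso[OF \<open>k > 0\<close>]] by simp
  qed
qed

theorem theorem1p10: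
  fixes G :: "nat \<Rightarrow> nat pair_pre_digraph"
  assumes "enumerates_finite_graphs G"
  shows "c_sup G (complete_graph 3) (cycle_graph 5)
           = c_weighted G (10 / 17) (complete_graph 3) (cycle_graph 5)
         \<and> c_weighted G (10 / 17) (complete_graph 3) (cycle_graph 5) = ereal (3 / 34)"
proof -
  let ?c = "\<lambda>l. c_weighted G l (complete_graph 3) (cycle_graph 5)"
  \<comment> \<open>The two families give bounds linear in \<open>l\<close>, one increasing and one
    decreasing, which meet at \<open>l = 10 / 17\<close> with value 3/34. The case split selects the
    smaller one.\<close>
  have upper: "?c l \<le> ereal (3 / 34)" if "0 \<le> l" "l \<le> 2" for l
  proof (cases "l \<le> 10 / 17")
    case True
    have pg: "pair_graph (blow_up prism 6 k)" for k
      by (rule pair_graph_blow_up[OF prism_sym]) (simp_all add: prism_def)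
    show ?thesis
    proof (rule c_weighted_le[OF assms _ pg])
      fix k :: nat assume "k > 0"
      have triangles: "hom_density (complete_graph 3) (blow_up prism 6 k) = 12 / 6 ^ 3"
        unfolding hom_density_complete_graph_3_blow_up[OF pg \<open>k > 0\<close>] prism_walks by simp
      have "hom_density (cycle_graph 5) (graph_complement (blow_up prism 6 k)) \<le> 306 / 6 ^ 5"
        using hom_density_cycle_graph_5_blow_up[OF pg \<open>k > 0\<close>] unfolding prism_walks by simp
      then have "(2 - l) * hom_density (cycle_graph 5) (graph_complement (blow_up prism 6 k))
          \<le> (2 - l) * (306 / 6 ^ 5)"
        using that by (intro mult_left_mono) simp_all
      then have "density_value l (blow_up prism 6 k) \<le> l * (12 / 6 ^ 3) + (2 - l) * (306 / 6 ^ 5)"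
        unfolding density_value_def triangles by linarith
      also have "\<dots> \<le> 3 / 34"
        using True by (simp add: field_simps)
      finally show "density_value l (blow_up prism 6 k) \<le> 3 / 34" .
    qed simp
  next
    case False
    \<comment> \<open>This blow-up of an edge is the balanced complete bipartite graph. The
      complementary pattern is two separate loops with two closed walks of length 5, whence 2/32 =
      1/16.\<close>
    have pg: "pair_graph (blow_up (\<noteq>) 2 k)" for k
      by (intro pair_graph_blow_up) auto
    show ?thesis
    proof (rule c_weighted_le[OF assms _ pg])
      fix k :: nat assume "k > 0"
      have triangles: "hom_density (complete_graph 3) (blow_up (\<noteq>) 2 k) = 0"
        unfolding hom_density_complete_graph_3_blow_up[OF pg \<open>k > 0\<close>]
        by (simp add: numeral_eq_Suc lessThan_Suc)
      have "hom_density (cycle_graph 5) (graph_complement (blow_up (\<noteq>) 2 k)) \<le> 1 / 16"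
        using hom_density_cycle_graph_5_blow_up[OF pg \<open>k > 0\<close>]
        by (simp add: numeral_eq_Suc lessThan_Suc)
      then have "(2 - l) * hom_density (cycle_graph 5) (graph_complement (blow_up (\<noteq>) 2 k))
          \<le> (2 - l) * (1 / 16)"
        using that by (intro mult_left_mono) simp_all
      then have "density_value l (blow_up (\<noteq>) 2 k) \<le> (2 - l) * (1 / 16)"
        unfolding density_value_def triangles by simp
      also have "\<dots> \<le> 3 / 34"
        using False by (simp add: field_simps)
      finally show "density_value l (blow_up (\<noteq>) 2 k) \<le> 3 / 34" .
    qed simp
  qed
  \<comment> \<open>An enumeration need not be ordered by size, but every size is exceeded from some
    index on.\<close>
  have card: "filterlim (\<lambda>n. card (pverts (G n))) at_top sequentially"
    unfolding filterlim_at_top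
  proof (intro allI)
    fix Z :: nat
    have "eventually (\<lambda>n. \<not> card (pverts (G n)) \<le> Z) cofinite"
      using finite_card_le_enumeration[OF assms] by (simp add: eventually_cofinite)
    then show "eventually (\<lambda>n. Z \<le> card (pverts (G n))) sequentially"
      unfolding cofinite_eq_sequentially by (rule eventually_mono) simp
  qed
  have "(\<lambda>n. 3 / 34 - 120 / 17 / real (card (pverts (G n)))) \<longlonglongrightarrow> 3 / 34 - 0"
    by (intro tendsto_diff tendsto_const tendsto_divide_0[OF tendsto_const]
        filterlim_at_top_imp_at_infinity filterlim_compose[OF filterlim_real_sequentially card])
  then have "(\<lambda>n. ereal (3 / 34 - 120 / 17 / real (card (pverts (G n))))) \<longlonglongrightarrow> ereal (3 / 34)"
    by simp
  then have "ereal (3 / 34) = liminf (\<lambda>n. ereal (3 / 34 - 120 / 17 / real (card (pverts (G n)))))"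
    by (intro lim_imp_Liminf[symmetric]) simp_all
  also have "\<dots> \<le> ?c (10 / 17)"
    unfolding c_weighted_density_value
  proof (rule Liminf_mono)
    \<comment> \<open>\<open>density_lower_bound\<close> applies to non-empty graphs, so the
      comparison is made for large \<open>n\<close>.\<close>
    have "eventually (\<lambda>n. 1 \<le> card (pverts (G n))) sequentially"
      using card unfolding filterlim_at_top by blast
    then show "eventually (\<lambda>n. ereal (3 / 34 - 120 / 17 / real (card (pverts (G n))))
        \<le> ereal (density_value (10 / 17) (G n))) sequentially"
    proof (rule eventually_mono)
      fix n assume "1 \<le> card (pverts (G n))"
      then have "pverts (G n) \<noteq> {}" by auto
      then show "ereal (3 / 34 - 120 / 17 / real (card (pverts (G n)))) \<le> ereal (density_value (10 / 17) (G n))"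
        using density_lower_bound[of "G n"] assms
        by (simp add: density_value_def enumerates_finite_graphs_def)
    qed
  qed
  finally have eq: "?c (10 / 17) = ereal (3 / 34)"
    using upper[of "10 / 17"] by (intro antisym) simp_all
  have "c_sup G (complete_graph 3) (cycle_graph 5) = ?c (10 / 17)"
    unfolding c_sup_def eq
  proof (intro antisym SUP_least)
    show "ereal (3 / 34) \<le> (SUP l\<in>{0..2}. ?c l)"
      by (rule SUP_upper2[of "10 / 17"]) (simp_all add: eq)
  qed (use upper in auto)
  then show ?thesis using eq by simp
qed

end
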